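(* Let $G$ be a finite group, let $I$ and $\Lambda$ be finite nonempty index sets, and let $P=(p_{\lambda i})$ be a $\Lambda\times I$ matrix with entries in $G$. Suppose that $|I|>1$ or $|\Lambda|>1$. Then: (1) The commuting graph $\mathcal{G}(\mathcal{M}[G;I,\Lambda;P])$ is not connected, and its connected components are the subgraphs induced by the $\mathcal{H}$-classes of $\mathcal{M}[G;I,\Lambda;P]$. (2) All the connected components of $\mathcal{G}(\mathcal{M}[G;I,\Lambda;P])$ are isomorphic to the extended commuting graph $\mathcal{G}^*(G)$, and their diameter is equal to $0$ if $G$ is trivial, to $1$ if $G$ is abelian and not trivial, and to $2$ if $G$ is not abelian.
   Context: The Rees matrix semigroup $\mathcal{M}[G;I,\Lambda;P]$ over the group $G$ is the set $I\times G\times\Lambda$ with multiplication $(i,x,\lambda)(j,y,\mu)=(i,xp_{\lambda j}y,\mu)$. Its $\mathcal{H}$-classes (classes of Green's relation $\mathcal{H}$) are the sets $\{i\}\times G\times\{\lambda\}$ with $i\in I$, $\lambda\in\Lambda$. The center of a semigroup $S$ is $Z(S)=\{x\in S: xy=yx\text{ for all }y\in S\}$. For a finite non-commutative semigroup $S$, the commuting graph $\mathcal{G}(S)$ is the simple graph with vertex set $S\setminus Z(S)$ in which two distinct vertices $x,y$ are adjacent if and only if $xy=yx$. (Under the hypotheses of the claim, $\mathcal{M}[G;I,\Lambda;P]$ is non-commutative with empty center.) For a finite semigroup $S$ (possibly commutative), the extended commuting graph $\mathcal{G}^*(S)$ is the simple graph with vertex set $S$ in which two distinct vertices $x,y$ are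 adjacent if and only if $xy=yx$. The diameter of a graph is the maximum of the distances between its vertices, where the distance is the length (number of edges) of a shortest path. *)

theory Defs
  imports "HOL-Algebra.Elementary_Groups" "Graph_Theory.Graph_Theory"
begin

text \<open>
  A semigroup is given by its carrier set \<open>S\<close> together with its operation \<open>m\<close>, so that the same
  notions apply to a Rees matrix semigroup, which has no identity in general, and to a group
  \<open>G\<close> (as \<open>carrier G\<close> with the operation of \<open>G\<close>).
\<close>

definition semigroup_center :: "'a set \<Rightarrow> ('a \<Rightarrow> 'a \<Rightarrow> 'a) \<Rightarrow> 'a set" where
  "semigroup_center S m = {x \<in> S. \<forall>y\<in>S. m x y = m y x}"

text \<open>
  The principal left, right ideals \<open>S\<^sup>1 x\<close>, \<open>x S\<^sup>1\<close>. Whether or not \<open>S\<close> already has an identity,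
  adjoining one only adds the element \<open>x\<close> itself.
\<close>

definition principal_left_ideal :: "'a set \<Rightarrow> ('a \<Rightarrow> 'a \<Rightarrow> 'a) \<Rightarrow> 'a \<Rightarrow> 'a set" where
  "principal_left_ideal S m x = insert x ((\<lambda>s. m s x) ` S)"

definition principal_right_ideal :: "'a set \<Rightarrow> ('a \<Rightarrow> 'a \<Rightarrow> 'a) \<Rightarrow> 'a \<Rightarrow> 'a set" where
  "principal_right_ideal S m x = insert x ((\<lambda>s. m x s) ` S)"

definition green_L :: "'a set \<Rightarrow> ('a \<Rightarrow> 'a \<Rightarrow> 'a) \<Rightarrow> ('a \<times> 'a) set" where
  "green_L S m = {(x, y) \<in> S \<times> S. principal_left_ideal S m x = principal_left_ideal S m y}"

definition green_R :: "'a set \<Rightarrow> ('a \<Rightarrow> 'a \<Rightarrow> 'a) \<Rightarrow> ('a \<times> 'a) set" where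
  "green_R S m = {(x, y) \<in> S \<times> S. principal_right_ideal S m x = principal_right_ideal S m y}"

definition green_H :: "'a set \<Rightarrow> ('a \<Rightarrow> 'a \<Rightarrow> 'a) \<Rightarrow> ('a \<times> 'a) set" where
  "green_H S m = green_L S m \<inter> green_R S m"

definition rees_carrier ::
  "('a, 'b) monoid_scheme \<Rightarrow> 'i set \<Rightarrow> 'l set \<Rightarrow> ('i \<times> 'a \<times> 'l) set" where
  "rees_carrier G I L = I \<times> carrier G \<times> L"

definition rees_mult ::
  "('a, 'b) monoid_scheme \<Rightarrow> ('l \<Rightarrow> 'i \<Rightarrow> 'a) \<Rightarrow> 'i \<times> 'a \<times> 'l \<Rightarrow> 'i \<times> 'a \<times> 'l \<Rightarrow> 'i \<times> 'a \<times> 'l" where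
  "rees_mult G P = (\<lambda>(i, x, l) (j, y, k). (i, x \<otimes>\<^bsub>G\<^esub> P l j \<otimes>\<^bsub>G\<^esub> y, k))"

text \<open>
  Simple graphs are symmetric loop-free digraphs without parallel arcs (locale \<^locale>\<open>graph\<close>); an edge
  is represented by its two orientations.
\<close>

definition commutation_graph_on ::
  "'a set \<Rightarrow> ('a \<Rightarrow> 'a \<Rightarrow> 'a) \<Rightarrow> ('a, 'a \<times> 'a) pre_digraph" where
  "commutation_graph_on V m =
     \<lparr>verts = V, arcs = {(x, y). x \<in> V \<and> y \<in> V \<and> x \<noteq> y \<and> m x y = m y x}, tail = fst, head = snd\<rparr>"

definition commuting_graph ::
  "'a set \<Rightarrow> ('a \<Rightarrow> 'a \<Rightarrow> 'a) \<Rightarrow> ('a, 'a \<times> 'a) pre_digraph" where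
  "commuting_graph S m = commutation_graph_on (S - semigroup_center S m) m"

definition ext_commuting_graph ::
  "'a set \<Rightarrow> ('a \<Rightarrow> 'a \<Rightarrow> 'a) \<Rightarrow> ('a, 'a \<times> 'a) pre_digraph" where
  "ext_commuting_graph S m = commutation_graph_on S m"

definition connected_components :: "('a, 'b) pre_digraph \<Rightarrow> ('a, 'b) pre_digraph set" where
  "connected_components X = {C. pre_digraph.max_subgraph X Digraph_Component.connected C}"

text \<open>
  \<^const>\<open>wf_digraph.\<mu>\<close> with unit weights is the least number of arcs of a walk, and \<open>\<infinity>\<close> if there is none.
\<close>

definition graph_distance :: "('a, 'b) pre_digraph \<Rightarrow> 'a \<Rightarrow> 'a \<Rightarrow> ereal" where
  "graph_distance X u v = wf_digraph.\<mu> X (\<lambda>_. 1) u v"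

text \<open>For a finite graph with at least one vertex the supremum is a maximum.\<close>

definition graph_diameter :: "('a, 'b) pre_digraph \<Rightarrow> ereal" where
  "graph_diameter X = (SUP (u, v) \<in> verts X \<times> verts X. graph_distance X u v)"

lemma graph_commutation_graph_on:
  assumes "finite V"
  shows "graph (commutation_graph_on V m)"
proof -
  have "finite {(x, y). x \<in> V \<and> y \<in> V \<and> x \<noteq> y \<and> m x y = m y x}"
    by (rule finite_subset[of _ "V \<times> V"]) (use assms in auto)
  then show ?thesis
    using assms
    by unfold_locales
      (auto simp: commutation_graph_on_def arc_to_ends_def symmetric_def arcs_ends_def sym_def image_iff)
qed

lemma rees_H_classes:
  assumes G: "group G" and P: "\<And>l i. l \<in> L \<Longrightarrow> i \<in> I \<Longrightarrow> P l i \<in> carrier G"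
    and "I \<noteq> {}" "L \<noteq> {}"
  shows "rees_carrier G I L // green_H (rees_carrier G I L) (rees_mult G P) =
    {{i} \<times> carrier G \<times> {l} | i l. i \<in> I \<and> l \<in> L}"
proof -
  interpret group G by fact
  obtain i0 l0 where i0: "i0 \<in> I" and l0: "l0 \<in> L"
    using assms by blast
  let ?S = "rees_carrier G I L" and ?m = "rees_mult G P"
  have left: "principal_left_ideal ?S ?m (i, x, l) = I \<times> carrier G \<times> {l}"
    if "i \<in> I" "x \<in> carrier G" "l \<in> L" for i x l
  proof -
    have "(j, y, l) \<in> (\<lambda>s. ?m s (i, x, l)) ` ?S" if "j \<in> I" "y \<in> carrier G" for j y
    proof (rule image_eqI)
      show "(j, y, l) = ?m (j, y \<otimes>\<^bsub>G\<^esub> inv\<^bsub>G\<^esub> x \<otimes>\<^bsub>G\<^esub> inv\<^bsub>G\<^esub> (P l0 i), l0) (i, x, l)"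
        using that \<open>i \<in> I\<close> \<open>x \<in> carrier G\<close> P[OF l0 \<open>i \<in> I\<close>] by (simp add: rees_mult_def m_assoc)
      show "(j, y \<otimes>\<^bsub>G\<^esub> inv\<^bsub>G\<^esub> x \<otimes>\<^bsub>G\<^esub> inv\<^bsub>G\<^esub> (P l0 i), l0) \<in> ?S"
        using that \<open>x \<in> carrier G\<close> P[OF l0 \<open>i \<in> I\<close>] l0 by (simp add: rees_carrier_def)
    qed
    moreover have "(\<lambda>s. ?m s (i, x, l)) ` ?S \<subseteq> I \<times> carrier G \<times> {l}"
      using that P by (auto simp: rees_mult_def rees_carrier_def)
    ultimately show ?thesis
      using that by (auto simp: principal_left_ideal_def)
  qed
  have right: "principal_right_ideal ?S ?m (i, x, l) = {i} \<times> carrier G \<times> L"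
    if "i \<in> I" "x \<in> carrier G" "l \<in> L" for i x l
  proof -
    have "(i, y, k) \<in> (\<lambda>s. ?m (i, x, l) s) ` ?S" if "k \<in> L" "y \<in> carrier G" for k y
    proof (rule image_eqI)
      show "(i, y, k) = ?m (i, x, l) (i0, inv\<^bsub>G\<^esub> (P l i0) \<otimes>\<^bsub>G\<^esub> (inv\<^bsub>G\<^esub> x \<otimes>\<^bsub>G\<^esub> y), k)"
        using that \<open>l \<in> L\<close> \<open>x \<in> carrier G\<close> P[OF \<open>l \<in> L\<close> i0]
        by (simp add: rees_mult_def m_assoc inv_solve_left)
          (simp add: m_assoc[symmetric])
      show "(i0, inv\<^bsub>G\<^esub> (P l i0) \<otimes>\<^bsub>G\<^esub> (inv\<^bsub>G\<^esub> x \<otimes>\<^bsub>G\<^esub> y), k) \<in> ?S"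
        using that \<open>x \<in> carrier G\<close> P[OF \<open>l \<in> L\<close> i0] i0 by (simp add: rees_carrier_def)
    qed
    moreover have "(\<lambda>s. ?m (i, x, l) s) ` ?S \<subseteq> {i} \<times> carrier G \<times> L"
      using that P by (auto simp: rees_mult_def rees_carrier_def)
    ultimately show ?thesis
      using that by (auto simp: principal_right_ideal_def)
  qed
  have cls: "green_H ?S ?m `` {(i, x, l)} = {i} \<times> carrier G \<times> {l}"
    if "i \<in> I" "x \<in> carrier G" "l \<in> L" for i x l
  proof -
    have eqL: "I \<times> carrier G \<times> {l} = I \<times> carrier G \<times> {k} \<longleftrightarrow> l = k" for k
      using i0 one_closed by blast
    have eqR: "{i} \<times> carrier G \<times> L = {j} \<times> carrier G \<times> L \<longleftrightarrow> i = j" for j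
      using l0 one_closed by blast
    have "((i, x, l), (j, y, k)) \<in> green_H ?S ?m \<longleftrightarrow> j = i \<and> y \<in> carrier G \<and> k = l" for j y k
    proof (cases "j \<in> I \<and> y \<in> carrier G \<and> k \<in> L")
      case True
      then have "((i, x, l), (j, y, k)) \<in> green_H ?S ?m \<longleftrightarrow> l = k \<and> i = j"
        using that left[OF that] right[OF that] left[of j y k] right[of j y k] eqL[of k] eqR[of j]
        by (simp add: green_H_def green_L_def green_R_def)
          (simp add: rees_carrier_def)
      then show ?thesis using True by blast
    next
      case False
      then show ?thesis
        using that by (auto simp: green_H_def green_L_def green_R_def rees_carrier_def)
    qed
    then show ?thesis by auto
  qed
  show ?thesis
  proof
    show "?S // green_H ?S ?m \<subseteq> {{i} \<times> carrier G \<times> {l} | i l. i \<in> I \<and> l \<in> L}"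
      using cls by (fastforce simp: quotient_def rees_carrier_def)
    show "{{i} \<times> carrier G \<times> {l} | i l. i \<in> I \<and> l \<in> L} \<subseteq> ?S // green_H ?S ?m"
    proof
      fix A assume "A \<in> {{i} \<times> carrier G \<times> {l} | i l. i \<in> I \<and> l \<in> L}"
      then obtain i l where il: "i \<in> I" "l \<in> L" "A = {i} \<times> carrier G \<times> {l}" by blast
      then have "A = green_H ?S ?m `` {(i, \<one>\<^bsub>G\<^esub>, l)}" "(i, \<one>\<^bsub>G\<^esub>, l) \<in> ?S"
        using cls by (auto simp: rees_carrier_def)
      then show "A \<in> ?S // green_H ?S ?m" by (auto intro: quotientI)
    qed
  qed
qed

end

theory Submission
  imports Defs
begin

text \<open>
  The elements \<open>(i, x, l)\<close> and \<open>(j, y, k)\<close> can only commute if \<open>i = j\<close> and \<open>l = k\<close>, because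
  the outer coordinates of a product come from different factors. So no edge leaves an
  \<open>\<H>\<close>-class. As there are at least two of these classes, no element is central, all elements are
  vertices, and the graph is not connected. Inside the class \<open>{i} \<times> G \<times> {l}\<close>, with
  \<open>p = P l i\<close>, commuting means \<open>x p y = y p x\<close>. After multiplication by \<open>p\<close> on the right, this
  says that \<open>x p\<close> and \<open>y p\<close> commute in \<open>G\<close> (\<open>commute_iff\<close>). Hence \<open>(i, x, l) \<mapsto> x p\<close> is an
  isomorphism from the subgraph induced by the class onto the extended commuting graph of \<open>G\<close>.

  The element \<open>(i, p\<inverse>, l)\<close>, which corresponds to the identity of \<open>G\<close>, is a hub: it commutes with
  the whole class. Therefore each class is connected, which makes it a component, and any two of its
  vertices are at distance at most \<open>2\<close>. Two elements are at distance \<open>2\<close> exactly if they do not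
  commute, and such a pair exists exactly if \<open>G\<close> is not abelian; otherwise the diameter only
  records whether the class has a second element (\<open>graph_diameter_H_class\<close>).

  Components are maximal connected subgraphs. They are identified by way of strongly connected
  components, which are the equivalence classes of mutual reachability
  (\<open>connected_components_eq_sccs\<close>).
\<close>

section \<open>Distance in a digraph\<close>

context wf_digraph
begin

lemma graph_distance_conv_length:
  "graph_distance G u v = (INF p\<in>{p. awalk u p v}. ereal (length p))"
proof -
  have "awalk_cost (\<lambda>_. 1) p = length p" for p
    by (induction p) auto
  then show ?thesis
    by (simp add: graph_distance_def \<mu>_def)
qed

lemma graph_distance_le_length: "awalk u p v \<Longrightarrow> graph_distance G u v \<le> ereal (length p)"
  unfolding graph_distance_conv_length by (rule INF_lower) simp

lemma graph_distance_nonneg: "0 \<le> graph_distance G u v"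
  unfolding graph_distance_conv_length by (rule INF_greatest) simp

lemma graph_distance_self: "u \<in> verts G \<Longrightarrow> graph_distance G u u = 0"
  using graph_distance_le_length[of u "[]" u] graph_distance_nonneg[of u u]
  by (simp add: awalk_Nil_iff zero_ereal_def[symmetric])

lemma graph_distance_ge_1:
  assumes "u \<noteq> v"
  shows "1 \<le> graph_distance G u v"
  unfolding graph_distance_conv_length
proof (rule INF_greatest)
  fix p assume "p \<in> {p. awalk u p v}"
  with assms have "1 \<le> length p"
    by (cases p) (auto simp: awalk_Nil_iff)
  then show "1 \<le> ereal (length p)" by simp
qed

lemma graph_distance_ge_2:
  assumes "u \<noteq> v" and "\<not> u \<rightarrow> v"
  shows "2 \<le> graph_distance G u v"
  unfolding graph_distance_conv_length
proof (rule INF_greatest)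
  fix p assume p: "p \<in> {p. awalk u p v}"
  have "p \<noteq> []" using p assms by (auto simp: awalk_Nil_iff)
  moreover have "p \<noteq> [e]" for e
    using p assms by (auto simp: awalk_simps in_arcs_imp_in_arcs_ends)
  ultimately have "2 \<le> length p"
    by (cases p rule: list.exhaust; cases "tl p") auto
  then show "2 \<le> ereal (length p)" by simp
qed

lemma graph_distance_le_1:
  assumes "u \<rightarrow> v"
  shows "graph_distance G u v \<le> 1"
proof -
  obtain e where e: "e \<in> arcs G" "tail G e = u" "head G e = v"
    using assms by (rule reachableE)
  then have "awalk u [e] v" by (auto simp: awalk_simps)
  then show ?thesis using graph_distance_le_length[of u "[e]" v] by (simp add: one_ereal_def)
qed

lemma graph_distance_le_2:
  assumes "u \<rightarrow> w" and "w \<rightarrow> v"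
  shows "graph_distance G u v \<le> 2"
proof -
  obtain e where e: "e \<in> arcs G" "tail G e = u" "head G e = w"
    using assms(1) by (rule reachableE)
  obtain f where f: "f \<in> arcs G" "tail G f = w" "head G f = v"
    using assms(2) by (rule reachableE)
  have "awalk u [e, f] v" using e f by (auto simp: awalk_simps)
  then show ?thesis using graph_distance_le_length[of u "[e, f]" v] by simp
qed

end

lemma graph_diameter_leI:
  assumes "\<And>u v. u \<in> verts X \<Longrightarrow> v \<in> verts X \<Longrightarrow> graph_distance X u v \<le> d"
  shows "graph_diameter X \<le> d"
  unfolding graph_diameter_def using assms by (auto intro: SUP_least)

lemma graph_distance_le_diameter:
  assumes "u \<in> verts X" and "v \<in> verts X"
  shows "graph_distance X u v \<le> graph_diameter X"
  unfolding graph_diameter_def using assms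
  by (auto intro: SUP_upper2[where i = "(u, v)"])


section \<open>Connected components of symmetric digraphs\<close>

lemma (in wf_digraph) strongly_connected_imp_connected:
  assumes "strongly_connected G"
  shows "Digraph_Component.connected G"
  using assms by (intro connectedI reachable_mk_symmetricI) (auto simp: strongly_connected_def)

lemma (in sym_digraph) connected_iff_strongly_connected:
  "Digraph_Component.connected G \<longleftrightarrow> strongly_connected G"
  using strongly_connected_imp_connected symmetric_connected_imp_strongly_connected[OF sym_arcs]
  by blast

lemma arc_mono_connected: "arc_mono Digraph_Component.connected"
  unfolding arc_mono_def spanning_def[symmetric]
  by (metis spanning_def subgraphE wf_digraph.connected_spanning_imp_connected)

text \<open>
  A subgraph of a symmetric digraph may lack the reverse of one of its arcs, so that it can be
  connected without being strongly connected. A maximal connected subgraph is induced, however,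
  and hence symmetric, and for symmetric digraphs the two notions agree.
\<close>

lemma (in sym_digraph) connected_components_eq_sccs: "connected_components G = sccs"
proof -
  have strong: "strongly_connected (G \<restriction> verts H)"
    if H: "subgraph H G" and conn: "Digraph_Component.connected H" for H
  proof -
    have ind: "induced_subgraph (G \<restriction> verts H) G" using H by (auto intro: induced_induce)
    interpret H': sym_digraph "G \<restriction> verts H" by (rule induced_graph_imp_graph[OF ind])
    have "Digraph_Component.connected (G \<restriction> verts H)"
      using arc_mono_connected conn subgraph_induce_subgraphI2[OF H]
      unfolding arc_mono_def by (metis induce_subgraph_verts)
    then show ?thesis by (simp add: H'.connected_iff_strongly_connected)
  qed
  have "max_subgraph Digraph_Component.connected H \<longleftrightarrow> max_subgraph strongly_connected H" for H
  proof
    assume max: "max_subgraph Digraph_Component.connected H"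
    then have "induced_subgraph H G" using arc_mono_connected by (rule induced_subgraphI_arc_mono)
    then have "G \<restriction> verts H = H" by (rule induce_eq_iff_induced)
    then have "strongly_connected H"
      using strong max unfolding max_subgraph_def by metis
    then show "max_subgraph strongly_connected H"
      using max unfolding max_subgraph_def
      by (meson subgraphE wf_digraph.strongly_connected_imp_connected)
  next
    assume max: "max_subgraph strongly_connected H"
    then have H: "subgraph H G" "strongly_connected H" by (auto simp: max_subgraph_def)
    show "max_subgraph Digraph_Component.connected H"
    proof (rule max_subgraphI)
      show "Digraph_Component.connected H"
        using H by (meson subgraphE wf_digraph.strongly_connected_imp_connected)
      show "subgraph H G" by fact
    next
      fix K assume K: "H \<noteq> K" "subgraph H K" "subgraph K G"
      show "\<not> Digraph_Component.connected K"
      proof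
        assume "Digraph_Component.connected K"
        then have "strongly_connected (G \<restriction> verts K)" using strong K by blast
        moreover have K': "subgraph K (G \<restriction> verts K)" using K(3) by (rule subgraph_induce_subgraphI2)
        moreover have "subgraph H (G \<restriction> verts K)" using K(2) K' by (rule subgraph_trans)
        moreover have "subgraph (G \<restriction> verts K) G" using K(3) by (auto intro: subgraph_induce_subgraphI)
        ultimately have "H = G \<restriction> verts K" using max unfolding max_subgraph_def by metis
        then have "subgraph K H" using K' by simp
        then have "H = K"
          using K(2) by (intro pre_digraph.equality) (auto simp: subgraph_def compatible_def)
        with K(1) show False ..
      qed
    qed
  qed
  then show ?thesis by (simp add: connected_components_def sccs_altdef2)
qed


section \<open>Commutation graphs\<close>

lemma wf_digraph_commutation_graph_on: "wf_digraph (commutation_graph_on V m)"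
  by unfold_locales (auto simp: commutation_graph_on_def)

lemma sym_digraph_commutation_graph_on: "sym_digraph (commutation_graph_on V m)"
  by unfold_locales (auto simp: commutation_graph_on_def symmetric_conv)

lemma verts_commutation_graph_on [simp]: "verts (commutation_graph_on V m) = V"
  by (simp add: commutation_graph_on_def)

lemma dominates_commutation_graph_on:
  "u \<rightarrow>\<^bsub>commutation_graph_on V m\<^esub> v \<longleftrightarrow> u \<in> V \<and> v \<in> V \<and> u \<noteq> v \<and> m u v = m v u"
  by (force simp: commutation_graph_on_def arcs_ends_conv)

lemma induce_commutation_graph_on:
  "W \<subseteq> V \<Longrightarrow> commutation_graph_on V m \<restriction> W = commutation_graph_on W m"
  by (auto simp: commutation_graph_on_def induce_subgraph_def)

text \<open>
  An arc is the pair of its ends, so a bijection of the vertices alone determines the map on arcs.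
\<close>

lemma digraph_iso_commutation_graph_on:
  assumes bij: "bij_betw f V W"
    and comm: "\<And>u v. u \<in> V \<Longrightarrow> v \<in> V \<Longrightarrow> m u v = m v u \<longleftrightarrow> n (f u) (f v) = n (f v) (f u)"
  shows "digraph_iso (commutation_graph_on V m) (commutation_graph_on W n)"
proof -
  let ?X = "commutation_graph_on V m" and ?Y = "commutation_graph_on W n"
  let ?h = "\<lparr>iso_verts = f, iso_arcs = map_prod f f, iso_head = snd, iso_tail = fst\<rparr>"
  have inj: "inj_on f V" and img: "f ` V = W"
    using bij by (auto simp: bij_betw_def)
  have "pre_digraph.digraph_isomorphism ?X ?h"
    unfolding pre_digraph.digraph_isomorphism_def
    using inj wf_digraph_commutation_graph_on[of V m]
    by (auto simp: commutation_graph_on_def inj_on_def)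
  moreover have "map_prod f f ` arcs ?X = arcs ?Y"
  proof
    show "map_prod f f ` arcs ?X \<subseteq> arcs ?Y"
      using inj img comm by (auto simp: commutation_graph_on_def inj_on_eq_iff)
    show "arcs ?Y \<subseteq> map_prod f f ` arcs ?X"
    proof
      fix a assume a: "a \<in> arcs ?Y"
      then obtain u v where uv: "u \<in> V" "v \<in> V" "a = map_prod f f (u, v)"
        using img by (fastforce simp: commutation_graph_on_def)
      moreover have "(u, v) \<in> arcs ?X"
        using a uv comm by (auto simp: commutation_graph_on_def)
      ultimately show "a \<in> map_prod f f ` arcs ?X" by blast
    qed
  qed
  then have "?Y = app_iso ?h ?X"
    using img by (simp add: commutation_graph_on_def app_iso_def)
  ultimately show ?thesis unfolding digraph_iso_def by blast
qed

text \<open>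
  A hub, a vertex that commutes with every other one, gives each pair of vertices a path of length
  at most \<open>2\<close>. The identity of a group is one, and so is the idempotent of each \<open>\<H>\<close>-class of a
  Rees matrix semigroup over a group. With a hub the diameter only depends on whether there is a
  second vertex and whether all elements commute.
\<close>

locale commutation_graph_with_hub =
  fixes V :: "'a set" and m :: "'a \<Rightarrow> 'a \<Rightarrow> 'a" and z :: 'a
  assumes hub_in: "z \<in> V" and hub_commutes: "v \<in> V \<Longrightarrow> m z v = m v z"
begin

abbreviation "X \<equiv> commutation_graph_on V m"

sublocale X: sym_digraph X
  by (rule sym_digraph_commutation_graph_on)

lemma reachable_via_hub:
  assumes "u \<in> V" and "v \<in> V"
  shows "u \<rightarrow>\<^sup>*\<^bsub>X\<^esub> v"
proof -
  have "w \<rightarrow>\<^sup>*\<^bsub>X\<^esub> z" if "w \<in> V" for w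
    using that hub_in hub_commutes
    by (cases "w = z") (auto simp: dominates_commutation_graph_on intro: X.reachable_adjI)
  then show ?thesis
    using assms X.symmetric_reachable' X.reachable_trans by blast
qed

lemma graph_diameter_singleton:
  assumes "V = {z}"
  shows "graph_diameter X = 0"
  using graph_diameter_leI[of X 0] graph_distance_le_diameter[of z X z] X.graph_distance_self[of z] assms
  by (auto intro!: antisym)

lemma graph_diameter_commutative:
  assumes "V \<noteq> {z}" and comm: "\<And>u v. u \<in> V \<Longrightarrow> v \<in> V \<Longrightarrow> m u v = m v u"
  shows "graph_diameter X = 1"
proof (rule antisym)
  show "graph_diameter X \<le> 1"
  proof (rule graph_diameter_leI)
    fix u v assume "u \<in> verts X" "v \<in> verts X"
    then show "graph_distance X u v \<le> 1"
      using comm X.graph_distance_self[of u] X.graph_distance_le_1[of u v]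
      by (cases "u = v") (auto simp: dominates_commutation_graph_on)
  qed
  obtain v where v: "v \<in> V" "v \<noteq> z" using assms(1) hub_in by blast
  then have "1 \<le> graph_distance X v z" by (intro X.graph_distance_ge_1)
  also have "\<dots> \<le> graph_diameter X"
    using v hub_in by (intro graph_distance_le_diameter) auto
  finally show "1 \<le> graph_diameter X" .
qed

lemma graph_diameter_noncommutative:
  assumes "a \<in> V" "b \<in> V" "m a b \<noteq> m b a"
  shows "graph_diameter X = 2"
proof (rule antisym)
  show "graph_diameter X \<le> 2"
  proof (rule graph_diameter_leI)
    fix u v assume uv: "u \<in> verts X" "v \<in> verts X"
    consider "u = v" | "u \<rightarrow>\<^bsub>X\<^esub> v" | "u \<rightarrow>\<^bsub>X\<^esub> z" "z \<rightarrow>\<^bsub>X\<^esub> v"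
      using uv hub_in hub_commutes unfolding dominates_commutation_graph_on by auto metis+
    then show "graph_distance X u v \<le> 2"
    proof cases
      case 1
      then show ?thesis using X.graph_distance_self[of u] uv by simp
    next
      case 2
      then have "graph_distance X u v \<le> 1" by (rule X.graph_distance_le_1)
      also have "(1::ereal) \<le> 2" by simp
      finally show ?thesis .
    next
      case 3
      then show ?thesis by (rule X.graph_distance_le_2)
    qed
  qed
  have "a \<noteq> b" using assms(3) by blast
  then have "2 \<le> graph_distance X a b"
    using assms by (intro X.graph_distance_ge_2) (auto simp: dominates_commutation_graph_on)
  also have "\<dots> \<le> graph_diameter X"
    using assms by (intro graph_distance_le_diameter) auto
  finally show "2 \<le> graph_diameter X" .
qed

end


section \<open>Commutation in Rees matrix semigroups\<close>

text \<open>
  Right translation by \<open>p\<close> turns the sandwich product \<open>(x, y) \<mapsto> x p y\<close> into the product of the group.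
\<close>

lemma (in group) commute_iff_translates_commute:
  assumes "x \<in> carrier G" "y \<in> carrier G" "p \<in> carrier G"
  shows "x \<otimes> p \<otimes> y = y \<otimes> p \<otimes> x \<longleftrightarrow> (x \<otimes> p) \<otimes> (y \<otimes> p) = (y \<otimes> p) \<otimes> (x \<otimes> p)"
proof -
  have "x \<otimes> p \<otimes> y = y \<otimes> p \<otimes> x \<longleftrightarrow> (x \<otimes> p \<otimes> y) \<otimes> p = (y \<otimes> p \<otimes> x) \<otimes> p"
    using assms by simp
  then show ?thesis using assms by (simp add: m_assoc)
qed

locale rees_matrix = group G for G (structure) +
  fixes I :: "'i set" and \<Lambda> :: "'l set" and P :: "'l \<Rightarrow> 'i \<Rightarrow> 'a"
  assumes entry_closed: "l \<in> \<Lambda> \<Longrightarrow> i \<in> I \<Longrightarrow> P l i \<in> carrier G"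
begin

abbreviation "S \<equiv> rees_carrier G I \<Lambda>"

abbreviation "rmult \<equiv> rees_mult G P"

abbreviation "H_class i l \<equiv> {i} \<times> carrier G \<times> {l}"

lemma commute_iff:
  assumes "(i, x, l) \<in> S" and "(j, y, k) \<in> S"
  shows "rmult (i, x, l) (j, y, k) = rmult (j, y, k) (i, x, l) \<longleftrightarrow>
    i = j \<and> l = k \<and> (x \<otimes> P l i) \<otimes> (y \<otimes> P l i) = (y \<otimes> P l i) \<otimes> (x \<otimes> P l i)"
  using assms commute_iff_translates_commute[of x y "P l i"] entry_closed
  by (auto simp: rees_mult_def rees_carrier_def)

lemma H_class_subset: "i \<in> I \<Longrightarrow> l \<in> \<Lambda> \<Longrightarrow> H_class i l \<subseteq> S"
  by (auto simp: rees_carrier_def)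

lemma bij_betw_translate_H_class:
  assumes "i \<in> I" "l \<in> \<Lambda>"
  shows "bij_betw (\<lambda>(_, x, _). x \<otimes> P l i) (H_class i l) (carrier G)"
  using entry_closed[OF assms(2,1)]
  by (intro bij_betw_byWitness[where f' = "\<lambda>g. (i, g \<otimes> inv P l i, l)"]) (auto simp: m_assoc)

lemma digraph_iso_H_class:
  assumes "i \<in> I" "l \<in> \<Lambda>"
  shows "digraph_iso (commutation_graph_on (H_class i l) rmult) (ext_commuting_graph (carrier G) (\<otimes>))"
  unfolding ext_commuting_graph_def
  by (rule digraph_iso_commutation_graph_on[OF bij_betw_translate_H_class[OF assms]])
    (use assms in \<open>auto simp: commute_iff rees_carrier_def\<close>)

text \<open>The hub is the preimage of the identity under the translation \<open>x \<mapsto> x p\<close>.\<close>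

lemma H_class_hub:
  assumes "i \<in> I" "l \<in> \<Lambda>"
  shows "commutation_graph_with_hub (H_class i l) rmult (i, inv P l i, l)"
  using assms entry_closed[OF assms(2,1)]
  by unfold_locales (auto simp: commute_iff rees_carrier_def)

lemma graph_diameter_H_class:
  assumes "i \<in> I" "l \<in> \<Lambda>"
  defines "C \<equiv> commutation_graph_on (H_class i l) rmult"
  shows "trivial_group G \<Longrightarrow> graph_diameter C = 0"
    and "comm_group G \<Longrightarrow> \<not> trivial_group G \<Longrightarrow> graph_diameter C = 1"
    and "\<not> comm_group G \<Longrightarrow> graph_diameter C = 2"
proof -
  have p: "P l i \<in> carrier G" using assms entry_closed by blast
  interpret hub: commutation_graph_with_hub "H_class i l" rmult "(i, inv P l i, l)"
    using assms by (intro H_class_hub)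
  have "trivial_group G \<longleftrightarrow> carrier G = {inv P l i}"
    unfolding trivial_group using inv_closed[OF p] by (metis singletonD)
  moreover have "{i} \<times> A \<times> {l} = {(i, q, l)} \<longleftrightarrow> A = {q}" for A and q :: 'a
    by auto
  ultimately have singleton: "H_class i l = {(i, inv P l i, l)} \<longleftrightarrow> trivial_group G"
    by (simp only:)
  show "graph_diameter C = 0" if "trivial_group G"
    unfolding C_def using that by (intro hub.graph_diameter_singleton) (simp only: singleton)
  show "graph_diameter C = 1" if "comm_group G" "\<not> trivial_group G"
    unfolding C_def
  proof (rule hub.graph_diameter_commutative)
    interpret comm_group G by fact
    show "H_class i l \<noteq> {(i, inv P l i, l)}" using that(2) by (simp only: singleton not_False_eq_True)
    show "rmult u v = rmult v u" if uv: "u \<in> H_class i l" "v \<in> H_class i l" for u v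
    proof -
      obtain x y where "u = (i, x, l)" "x \<in> carrier G" "v = (i, y, l)" "y \<in> carrier G"
        using uv by auto
      moreover from this have "(x \<otimes> P l i) \<otimes> (y \<otimes> P l i) = (y \<otimes> P l i) \<otimes> (x \<otimes> P l i)"
        using p by (intro m_comm) auto
      ultimately show ?thesis
        using commute_iff[of i x l i y l] assms(1,2) by (simp add: rees_carrier_def)
    qed
  qed
  show "graph_diameter C = 2" if noncomm: "\<not> comm_group G"
  proof -
    obtain g h where gh: "g \<in> carrier G" "h \<in> carrier G" "g \<otimes> h \<noteq> h \<otimes> g"
      using noncomm group_comm_groupI by blast
    \<comment> \<open>The preimages of \<open>g\<close> and \<open>h\<close> under the translation by \<open>P l i\<close> do not commute either.\<close>
    then have "rmult (i, g \<otimes> inv P l i, l) (i, h \<otimes> inv P l i, l)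
        \<noteq> rmult (i, h \<otimes> inv P l i, l) (i, g \<otimes> inv P l i, l)"
      using p assms(1,2)
        commute_iff[of i "g \<otimes> inv P l i" l i "h \<otimes> inv P l i" l]
      by (simp add: rees_carrier_def m_assoc)
    then show ?thesis
      unfolding C_def using gh p by (intro hub.graph_diameter_noncommutative) auto
  qed
qed


section \<open>The components of the commuting graph of a Rees matrix semigroup\<close>

text \<open>
  An element commutes with no element of another \<open>\<H>\<close>-class, and the hypothesis says that
  there is one.
\<close>

lemma center_empty:
  assumes "card I > 1 \<or> card \<Lambda> > 1"
  shows "semigroup_center S rmult = {}"
proof -
  have "\<exists>w\<in>S. rmult u w \<noteq> rmult w u" if u: "u \<in> S" for u
  proof -
    obtain i x l where ixl: "u = (i, x, l)" "i \<in> I" "x \<in> carrier G" "l \<in> \<Lambda>"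
      using u by (auto simp: rees_carrier_def)
    have "(\<exists>j\<in>I. j \<noteq> i) \<or> (\<exists>k\<in>\<Lambda>. k \<noteq> l)"
      using assms card_le_Suc0_iff_eq[of I] card_le_Suc0_iff_eq[of \<Lambda>] ixl
      by (metis One_nat_def card.infinite not_less not_less_zero)
    then obtain j k where "j \<in> I" "k \<in> \<Lambda>" "j \<noteq> i \<or> k \<noteq> l" using ixl by blast
    then show ?thesis
      using u ixl by (intro bexI[of _ "(j, x, k)"]) (auto simp: commute_iff rees_carrier_def)
  qed
  then show ?thesis by (auto simp: semigroup_center_def)
qed

text \<open>
  Edges preserve both indices, so a walk cannot leave the class; inside the class the hub links all
  elements.
\<close>

lemma reachable_iff_same_H_class:
  assumes "i \<in> I" "x \<in> carrier G" "l \<in> \<Lambda>"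
  shows "(i, x, l) \<rightarrow>\<^sup>*\<^bsub>commutation_graph_on S rmult\<^esub> v \<longleftrightarrow> v \<in> H_class i l"
proof
  interpret X: sym_digraph "commutation_graph_on S rmult"
    by (rule sym_digraph_commutation_graph_on)
  show "v \<in> H_class i l" if "(i, x, l) \<rightarrow>\<^sup>*\<^bsub>commutation_graph_on S rmult\<^esub> v"
    using that
  proof (induction rule: X.reachable_induct)
    case base
    then show ?case using assms by simp
  next
    case (step u w)
    then show ?case
      by (cases w) (auto simp: dominates_commutation_graph_on commute_iff rees_carrier_def)
  qed
  show "(i, x, l) \<rightarrow>\<^sup>*\<^bsub>commutation_graph_on S rmult\<^esub> v" if "v \<in> H_class i l"
  proof -
    interpret hub: commutation_graph_with_hub "H_class i l" rmult "(i, inv P l i, l)"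
      using assms by (intro H_class_hub)
    have "(i, x, l) \<rightarrow>\<^sup>*\<^bsub>commutation_graph_on (H_class i l) rmult\<^esub> v"
      using that assms by (intro hub.reachable_via_hub) auto
    then show ?thesis
      using X.reachable_induce_subgraphD[of "H_class i l" "(i, x, l)" v] H_class_subset[of i l] assms
      by (simp add: induce_commutation_graph_on)
  qed
qed

lemma connected_components_rees:
  "connected_components (commutation_graph_on S rmult)
     = (\<lambda>(i, l). commutation_graph_on S rmult \<restriction> H_class i l) ` (I \<times> \<Lambda>)"
proof -
  interpret X: sym_digraph "commutation_graph_on S rmult"
    by (rule sym_digraph_commutation_graph_on)
  have scc: "X.scc_of (i, x, l) = H_class i l" if "i \<in> I" "x \<in> carrier G" "l \<in> \<Lambda>" for i x l
    using reachable_iff_same_H_class[OF that] X.symmetric_reachable'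
    unfolding X.scc_of_def by blast
  have "X.scc_of ` S = (\<lambda>(i, l). H_class i l) ` (I \<times> \<Lambda>)"
  proof -
    have "X.scc_of u = H_class (fst u) (snd (snd u))" if "u \<in> S" for u
      using that scc by (auto simp: rees_carrier_def)
    then have "X.scc_of ` S = (\<lambda>(i, x, l). H_class i l) ` S"
      by (intro image_cong) (auto simp: case_prod_beta)
    also have "\<dots> = (\<lambda>(i, l). H_class i l) ` (I \<times> \<Lambda>)"
      by (force simp: rees_carrier_def)
    finally show ?thesis .
  qed
  then show ?thesis
    unfolding X.connected_components_eq_sccs X.sccs_conv_sccs_verts X.sccs_verts_conv_scc_of
    by (simp add: image_image case_prod_beta)
qed

lemma not_connected_rees:
  assumes "I \<noteq> {}" "\<Lambda> \<noteq> {}" and "card I > 1 \<or> card \<Lambda> > 1"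
  shows "\<not> Digraph_Component.connected (commutation_graph_on S rmult)"
proof
  interpret X: sym_digraph "commutation_graph_on S rmult"
    by (rule sym_digraph_commutation_graph_on)
  assume "Digraph_Component.connected (commutation_graph_on S rmult)"
  then have reach: "u \<rightarrow>\<^sup>*\<^bsub>commutation_graph_on S rmult\<^esub> v" if "u \<in> S" "v \<in> S" for u v
    using that by (auto simp: X.connected_iff_strongly_connected strongly_connected_def)
  obtain i l where il: "i \<in> I" "l \<in> \<Lambda>" using assms by blast
  have "S \<subseteq> H_class i l"
  proof
    fix v assume "v \<in> S"
    with il have "(i, \<one>, l) \<rightarrow>\<^sup>*\<^bsub>commutation_graph_on S rmult\<^esub> v"
      by (intro reach) (auto simp: rees_carrier_def)
    then show "v \<in> H_class i l" using il by (simp only: reachable_iff_same_H_class one_closed)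
  qed
  then have "I \<subseteq> {i}" "\<Lambda> \<subseteq> {l}" using il by (auto simp: rees_carrier_def)
  then have "card I \<le> 1" "card \<Lambda> \<le> 1"
    using card_mono[of "{i}" I] card_mono[of "{l}" \<Lambda>] by auto
  with assms(3) show False by linarith
qed

end

theorem theorem3p4:
  fixes G :: "('a, 'b) monoid_scheme"
    and I :: "'i set" and \<Lambda> :: "'l set"
    and P :: "'l \<Rightarrow> 'i \<Rightarrow> 'a"
  defines "S \<equiv> rees_carrier G I \<Lambda>"
    and "m \<equiv> rees_mult G P"
  assumes "group G" and "finite (carrier G)"
    and "finite I" and "I \<noteq> {}"
    and "finite \<Lambda>" and "\<Lambda> \<noteq> {}"
    and "\<And>l i. l \<in> \<Lambda> \<Longrightarrow> i \<in> I \<Longrightarrow> P l i \<in> carrier G"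
    and "card I > 1 \<or> card \<Lambda> > 1"
  shows "(\<not> Digraph_Component.connected (commuting_graph S m)
        \<and> connected_components (commuting_graph S m)
            = (\<lambda>H. induce_subgraph (commuting_graph S m) H) ` (S // green_H S m))
      \<and> (\<forall>C \<in> connected_components (commuting_graph S m).
          digraph_iso C (ext_commuting_graph (carrier G) (\<otimes>\<^bsub>G\<^esub>))
          \<and> (trivial_group G \<longrightarrow> graph_diameter C = 0)
          \<and> (comm_group G \<and> \<not> trivial_group G \<longrightarrow> graph_diameter C = 1)
          \<and> (\<not> comm_group G \<longrightarrow> graph_diameter C = 2))"
proof -
  interpret rees_matrix G I \<Lambda> P
    using assms by (simp add: rees_matrix_def rees_matrix_axioms_def)
  have graph: "commuting_graph S m = commutation_graph_on S m"
    using center_empty assms by (simp add: commuting_graph_def)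
  have comps: "connected_components (commutation_graph_on S m)
      = (\<lambda>(i, l). commutation_graph_on S m \<restriction> H_class i l) ` (I \<times> \<Lambda>)"
    unfolding S_def m_def by (rule connected_components_rees)
  have "S // green_H S m = {H_class i l | i l. i \<in> I \<and> l \<in> \<Lambda>}"
    unfolding S_def m_def using assms by (intro rees_H_classes) auto
  also have "\<dots> = (\<lambda>(i, l). H_class i l) ` (I \<times> \<Lambda>)" by auto
  finally have classes: "S // green_H S m = (\<lambda>(i, l). H_class i l) ` (I \<times> \<Lambda>)" .
  have "\<not> Digraph_Component.connected (commutation_graph_on S m)"
    unfolding S_def m_def using assms by (intro not_connected_rees) auto
  moreover have "connected_components (commutation_graph_on S m)
      = (\<lambda>H. commutation_graph_on S m \<restriction> H) ` (S // green_H S m)"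
    unfolding comps classes by (simp add: image_image case_prod_beta)
  moreover have "digraph_iso C (ext_commuting_graph (carrier G) (\<otimes>\<^bsub>G\<^esub>))
      \<and> (trivial_group G \<longrightarrow> graph_diameter C = 0)
      \<and> (comm_group G \<and> \<not> trivial_group G \<longrightarrow> graph_diameter C = 1)
      \<and> (\<not> comm_group G \<longrightarrow> graph_diameter C = 2)"
    if C: "C \<in> connected_components (commutation_graph_on S m)" for C
  proof -
    obtain i l where il: "i \<in> I" "l \<in> \<Lambda>" and "C = commutation_graph_on S m \<restriction> H_class i l"
      using C unfolding comps by auto
    then have "C = commutation_graph_on (H_class i l) m"
      using induce_commutation_graph_on[OF H_class_subset[OF il]] by (simp only: S_def)
    then show ?thesis
      using digraph_iso_H_class[OF il] graph_diameter_H_class[OF il] unfolding m_def by blast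
  qed
  ultimately show ?thesis unfolding graph by blast
qed

end
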